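(* Consider the 3-person non-initialized game $(\mathcal{G}_3,u)$ under the Markov realization, where the payoff $u$ satisfies $$u_1(a_2)>u_1(a_1)>u_1(a_3)>u_1(c),\quad u_2(a_3)>u_2(a_2)>u_2(a_1)>u_2(c),\quad u_3(a_1)>u_3(a_3)>u_3(a_2)>u_3(c).$$ Set $$\mu_1=\frac{u_1(a_2)-u_1(a_1)}{u_1(a_1)-u_1(a_3)},\quad \mu_2=\frac{u_2(a_3)-u_2(a_2)}{u_2(a_2)-u_2(a_1)},\quad \mu_3=\frac{u_3(a_1)-u_3(a_3)}{u_3(a_3)-u_3(a_2)}.$$ If $\mu_1\mu_2\mu_3\ge 1$, then $(\mathcal{G}_3,u)$ has no uniform Nash equilibrium in mixed strategies. If $\mu_1\mu_2\mu_3<1$, then $(\mathcal{G}_3,u)$ has a unique uniform Nash equilibrium in mixed strategies, and it is determined by the probabilities $$p_1=\frac{\mu_3(1+\mu_1+\mu_1\mu_2)}{1+\mu_3+\mu_3\mu_1},\quad p_2=\frac{\mu_1(1+\mu_2+\mu_2\mu_3)}{1+\mu_1+\mu_1\mu_2},\quad p_3=\frac{\mu_2(1+\mu_3+\mu_3\mu_1)}{1+\mu_2+\mu_2\mu_3}.$$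
   Context: Game structure $\mathcal{G}_3$: the directed graph has non-terminal positions $v_1,v_2,v_3$, terminal positions $a_1,a_2,a_3$, and arcs $(v_1,v_2),(v_2,v_3),(v_3,v_1)$ (the cycle) and $(v_i,a_i)$, $i=1,2,3$. Player $i\in\{1,2,3\}$ controls $v_i$. The outcomes are $a_1,a_2,a_3$ (termination there) and $c$ (infinite play). A payoff is $u:\{1,2,3\}\times\{a_1,a_2,a_3,c\}\to\mathbb{R}$, written $u_i(a)$. A mixed strategy of player $i$ is a number $p_i\in[0,1]$: the probability of following the cycle from $v_i$; with probability $1-p_i$ the player moves to $a_i$. Under the Markov realization the move is drawn afresh and independently each time a position is visited. Thus if $p_1=p_2=p_3=1$ the outcome is $c$ with probability 1 from every initial position; otherwise, with $\Delta=1-p_1p_2p_3$, the distribution on $(a_1,a_2,a_3,c)$ is $\frac1\Delta(1-p_1,\;p_1(1-p_2),\;p_1p_2(1-p_3),\;0)$ for initial position $v_1$, $\frac1\Delta(p_2p_3(1-p_1),\;1-p_2,\;p_2(1-p_3),\;0)$ for $v_2$, $\frac1\Delta(p_3(1-p_1),\;p_1p_3(1-p_2),\;1-p_3,\;0)$ for $v_3$. Player $i$'s expected payoff is the corresponding expectation of $u_i$. A triple $(p_1,p_2,p_3)\in[0,1]^3$ is a uniform Nash equilibrium (UNE) if for each initial position $v_j$, $j=1,2,3$, no player can strictly increase his expected payoff by changing only his own $p_i\in[0,1]$. *)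

theory Defs
  imports "HOL-Probability.Probability"
begin

datatype player = P1 | P2 | P3

fun next_player :: "player \<Rightarrow> player" where
  "next_player P1 = P2" | "next_player P2 = P3" | "next_player P3 = P1"

text \<open>
  The graph: \<open>V i\<close> is the non-terminal position controlled by player \<open>i\<close>, with arcs to
  \<open>V (next_player i)\<close> and to the terminal position \<open>A i\<close>.
\<close>

datatype position = V player | A player

text \<open>\<open>Term i\<close> is termination in \<open>A i\<close>; \<open>Cyc\<close> is the infinite play.\<close>

datatype outcome = Term player | Cyc

type_synonym payoff = "player \<Rightarrow> outcome \<Rightarrow> real"
type_synonym profile = "player \<Rightarrow> real"

text \<open>\<open>p i\<close> is the probability that player \<open>i\<close> follows the cycle from \<open>V i\<close>.\<close>

definition mixed_profiles :: "profile set" where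
  "mixed_profiles = {p. \<forall>i. 0 \<le> p i \<and> p i \<le> 1}"

text \<open>
  Markov realization: at every visit of \<open>V i\<close> the move is drawn afresh. Terminal positions
  are made absorbing, so \<open>walk p n x\<close> is the law of the position reached from \<open>x\<close> after
  \<open>n\<close> moves.
\<close>

fun move :: "profile \<Rightarrow> position \<Rightarrow> position pmf" where
  "move p (V i) = map_pmf (\<lambda>b. if b then V (next_player i) else A i) (bernoulli_pmf (p i))"
| "move p (A i) = return_pmf (A i)"

primrec walk :: "profile \<Rightarrow> nat \<Rightarrow> position \<Rightarrow> position pmf" where
  "walk p 0 x = return_pmf x"
| "walk p (Suc n) x = bind_pmf (move p x) (walk p n)"

text \<open>
  The events \<open>absorbed in A k by time n\<close> increase to \<open>termination in A k\<close>, and the events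
  \<open>not absorbed by time n\<close> decrease to \<open>infinite play\<close>; hence the limits.
\<close>

fun outcome_prob :: "profile \<Rightarrow> player \<Rightarrow> outcome \<Rightarrow> real" where
  "outcome_prob p j (Term k) = lim (\<lambda>n. pmf (walk p n (V j)) (A k))"
| "outcome_prob p j Cyc = lim (\<lambda>n. measure_pmf.prob (walk p n (V j)) (range V))"

text \<open>Expected payoff of player \<open>i\<close> when the play starts at \<open>V j\<close>.\<close>

definition expected_payoff :: "payoff \<Rightarrow> profile \<Rightarrow> player \<Rightarrow> player \<Rightarrow> real" where
  "expected_payoff u p j i =
     (\<Sum>k\<in>{P1, P2, P3}. outcome_prob p j (Term k) * u i (Term k)) + outcome_prob p j Cyc * u i Cyc"

definition uniform_nash :: "payoff \<Rightarrow> profile \<Rightarrow> bool" where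
  "uniform_nash u p \<longleftrightarrow> p \<in> mixed_profiles \<and>
     (\<forall>j i. \<forall>q\<in>{0..1}. expected_payoff u (p(i := q)) j i \<le> expected_payoff u p j i)"


subsection \<open>Closed form of the outcome distribution\<close>

lemma walk_A: "walk p n (A i) = return_pmf (A i)"
  by (induction n) (simp_all add: bind_return_pmf)

lemma walk_V:
  "walk p (Suc n) (V j) =
     bind_pmf (bernoulli_pmf (p j)) (\<lambda>b. if b then walk p n (V (next_player j)) else return_pmf (A j))"
  by (auto simp: bind_map_pmf walk_A intro!: bind_pmf_cong)

context
  fixes p :: profile
  assumes p: "p \<in> mixed_profiles"
begin

lemma p_bounds: "0 \<le> p i" "p i \<le> 1"
  using p by (auto simp: mixed_profiles_def)

lemma absorbed_Suc:
  "pmf (walk p (Suc n) (V j)) (A k) =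
     p j * pmf (walk p n (V (next_player j))) (A k) + (1 - p j) * (if j = k then 1 else 0)"
  unfolding walk_V by (simp add: pmf_bind p_bounds indicator_def)

lemma cycling_Suc:
  "measure_pmf.prob (walk p (Suc n) (V j)) (range V) =
     p j * measure_pmf.prob (walk p n (V (next_player j))) (range V)"
  unfolding walk_V measure_pmf_bind
  by (subst measure_pmf.measure_bind[where N = "count_space UNIV"])
     (auto simp: p_bounds measure_pmf_in_subprob_algebra image_iff)

lemma absorbed_convergent: "convergent (\<lambda>n. pmf (walk p n (V j)) (A k))"
proof -
  have "pmf (walk p n (V j)) (A k) \<le> pmf (walk p (Suc n) (V j)) (A k)" for n
  proof (induction n arbitrary: j)
    case 0
    show ?case by simp
  next
    case (Suc n)
    show ?case
      unfolding absorbed_Suc[of n j k] absorbed_Suc[of "Suc n" j k]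
      by (intro add_right_mono mult_left_mono Suc p_bounds)
  qed
  then have "incseq (\<lambda>n. pmf (walk p n (V j)) (A k))"
    by (rule incseq_SucI)
  then show ?thesis
    using pmf_le_1 by (metis convergentI incseq_convergent)
qed

lemma cycling_convergent: "convergent (\<lambda>n. measure_pmf.prob (walk p n (V j)) (range V))"
proof -
  have "measure_pmf.prob (walk p (Suc n) (V j)) (range V)
      \<le> measure_pmf.prob (walk p n (V j)) (range V)" for n
    unfolding cycling_Suc
  proof (induction n arbitrary: j)
    case 0
    show ?case by (simp add: p_bounds mult_le_one)
  next
    case (Suc n)
    show ?case
      unfolding cycling_Suc using Suc p_bounds by (intro mult_left_mono)
  qed
  then have "decseq (\<lambda>n. measure_pmf.prob (walk p n (V j)) (range V))"
    by (rule decseq_SucI)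
  then show ?thesis
    using measure_nonneg by (metis convergentI decseq_convergent)
qed

lemma outcome_prob_Term_eq:
  "outcome_prob p j (Term k) =
     p j * outcome_prob p (next_player j) (Term k) + (1 - p j) * (if j = k then 1 else 0)"
proof (rule LIMSEQ_unique)
  show "(\<lambda>n. pmf (walk p (Suc n) (V j)) (A k)) \<longlonglongrightarrow> outcome_prob p j (Term k)"
    using absorbed_convergent[of j k] unfolding outcome_prob.simps convergent_LIMSEQ_iff by (rule LIMSEQ_Suc)
  show "(\<lambda>n. pmf (walk p (Suc n) (V j)) (A k)) \<longlonglongrightarrow>
      p j * outcome_prob p (next_player j) (Term k) + (1 - p j) * (if j = k then 1 else 0)"
    unfolding absorbed_Suc using absorbed_convergent[of "next_player j" k]
    by (intro tendsto_intros) (simp only: outcome_prob.simps convergent_LIMSEQ_iff)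
qed

lemma outcome_prob_Cyc_eq: "outcome_prob p j Cyc = p j * outcome_prob p (next_player j) Cyc"
proof (rule LIMSEQ_unique)
  show "(\<lambda>n. measure_pmf.prob (walk p (Suc n) (V j)) (range V)) \<longlonglongrightarrow> outcome_prob p j Cyc"
    using cycling_convergent[of j]
    unfolding outcome_prob.simps convergent_LIMSEQ_iff by (rule LIMSEQ_Suc)
  show "(\<lambda>n. measure_pmf.prob (walk p (Suc n) (V j)) (range V)) \<longlonglongrightarrow>
      p j * outcome_prob p (next_player j) Cyc"
    unfolding cycling_Suc using cycling_convergent[of "next_player j"]
    by (intro tendsto_intros) (simp only: outcome_prob.simps convergent_LIMSEQ_iff)
qed

lemma outcome_prob_all_one:
  assumes "p P1 = 1" "p P2 = 1" "p P3 = 1"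
  shows "outcome_prob p j (Term k) = 0" "outcome_prob p j Cyc = 1"
proof -
  have one: "p i = 1" for i
    using assms by (cases i) auto
  have "pmf (walk p n (V j)) (A k) = 0" for n
  proof (induction n arbitrary: j)
    case (Suc n)
    then show ?case using absorbed_Suc[of n j k] one[of j] by (simp del: walk.simps)
  qed simp
  then show "outcome_prob p j (Term k) = 0"
    by simp
  have "measure_pmf.prob (walk p n (V j)) (range V) = 1" for n
  proof (induction n arbitrary: j)
    case (Suc n)
    then show ?case using cycling_Suc[of n j] one[of j] by (simp del: walk.simps)
  qed simp
  then show "outcome_prob p j Cyc = 1"
    by simp
qed

lemma outcome_prob_closed_form:
  assumes "\<not> (p P1 = 1 \<and> p P2 = 1 \<and> p P3 = 1)"
  defines "\<Delta> \<equiv> 1 - p P1 * p P2 * p P3"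
  shows "\<Delta> > 0"
    and "outcome_prob p P1 (Term P1) = (1 - p P1) / \<Delta>"
    and "outcome_prob p P1 (Term P2) = p P1 * (1 - p P2) / \<Delta>"
    and "outcome_prob p P1 (Term P3) = p P1 * p P2 * (1 - p P3) / \<Delta>"
    and "outcome_prob p P2 (Term P1) = p P2 * p P3 * (1 - p P1) / \<Delta>"
    and "outcome_prob p P2 (Term P2) = (1 - p P2) / \<Delta>"
    and "outcome_prob p P2 (Term P3) = p P2 * (1 - p P3) / \<Delta>"
    and "outcome_prob p P3 (Term P1) = p P3 * (1 - p P1) / \<Delta>"
    and "outcome_prob p P3 (Term P2) = p P1 * p P3 * (1 - p P2) / \<Delta>"
    and "outcome_prob p P3 (Term P3) = (1 - p P3) / \<Delta>"
    and "outcome_prob p j Cyc = 0"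
proof -
  have "p P1 * p P2 * p P3 \<le> p i" for i
  proof (cases i)
    case P1
    have "p P2 * p P3 \<le> 1" by (simp add: mult_le_one p_bounds)
    then show ?thesis
      using P1 mult_left_mono[of "p P2 * p P3" 1 "p P1"] p_bounds by (simp add: mult.assoc)
  next
    case P2
    have "p P1 * p P3 \<le> 1" by (simp add: mult_le_one p_bounds)
    then show ?thesis
      using P2 mult_left_mono[of "p P1 * p P3" 1 "p P2"] p_bounds by (simp add: mult_ac)
  next
    case P3
    have "p P1 * p P2 \<le> 1" by (simp add: mult_le_one p_bounds)
    then show ?thesis
      using P3 mult_left_mono[of "p P1 * p P2" 1 "p P3"] p_bounds by (simp add: mult_ac)
  qed
  from this[of P1] this[of P2] this[of P3] show pos: "\<Delta> > 0"
    using assms(1) p_bounds[of P1] p_bounds[of P2] p_bounds[of P3]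
    unfolding \<Delta>_def by linarith
  have solve: "x = a / \<Delta>" if "x = p P1 * p P2 * p P3 * x + a" for x a :: real
  proof -
    have "x * \<Delta> = a"
      using that by (simp add: \<Delta>_def algebra_simps)
    then show ?thesis
      using pos by (simp add: eq_divide_eq)
  qed
  have cycle3: "x = (a * b * d) * x + (a * b * f + a * e + c)"
    if "x = a * y + c" "y = b * z + e" "z = d * x + f" for x y z a b c d e f :: real
  proof -
    have "x = a * (b * (d * x + f) + e) + c"
      using that by simp
    also have "\<dots> = (a * b * d) * x + (a * b * f + a * e + c)"
      by (simp add: algebra_simps)
    finally show ?thesis .
  qed
  note T = outcome_prob_Term_eq[of P1] outcome_prob_Term_eq[of P2] outcome_prob_Term_eq[of P3]
  note T = T[unfolded next_player.simps]
  note C = outcome_prob_Cyc_eq[of P1] outcome_prob_Cyc_eq[of P2] outcome_prob_Cyc_eq[of P3]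
  note C = C[unfolded next_player.simps]
  have e1: "outcome_prob p P1 (Term k) = p P1 * p P2 * p P3 * outcome_prob p P1 (Term k)
      + (p P1 * p P2 * ((1 - p P3) * (if P3 = k then 1 else 0))
        + p P1 * ((1 - p P2) * (if P2 = k then 1 else 0)) + (1 - p P1) * (if P1 = k then 1 else 0))" for k
    by (rule cycle3[OF T(1) T(2) T(3)])
  have e2: "outcome_prob p P2 (Term k) = p P1 * p P2 * p P3 * outcome_prob p P2 (Term k)
      + (p P2 * p P3 * ((1 - p P1) * (if P1 = k then 1 else 0))
        + p P2 * ((1 - p P3) * (if P3 = k then 1 else 0)) + (1 - p P2) * (if P2 = k then 1 else 0))" for k
    using cycle3[OF T(2) T(3) T(1)] by (simp only: mult_ac)
  have e3: "outcome_prob p P3 (Term k) = p P1 * p P2 * p P3 * outcome_prob p P3 (Term k)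
      + (p P3 * p P1 * ((1 - p P2) * (if P2 = k then 1 else 0))
        + p P3 * ((1 - p P1) * (if P1 = k then 1 else 0)) + (1 - p P3) * (if P3 = k then 1 else 0))" for k
    using cycle3[OF T(3) T(1) T(2)] by (simp only: mult_ac)
  have cyc: "x = (a * b * d) * x + 0" if "x = a * y" "y = b * z" "z = d * x" for x y z a b d :: real
  proof -
    have "x = a * y + 0" "y = b * z + 0" "z = d * x + 0"
      unfolding add_0_right by (fact that)+
    from cycle3[OF this] show ?thesis
      unfolding mult_zero_right add_0_right .
  qed
  have e: "outcome_prob p j Cyc = p P1 * p P2 * p P3 * outcome_prob p j Cyc + 0"
  proof (cases j)
    case P1
    then show ?thesis using cyc[OF C(1) C(2) C(3)] by (simp only: mult_ac)
  next
    case P2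
    then show ?thesis using cyc[OF C(2) C(3) C(1)] by (simp only: mult_ac)
  next
    case P3
    then show ?thesis using cyc[OF C(3) C(1) C(2)] by (simp only: mult_ac)
  qed
  note s = solve[OF e1] solve[OF e2] solve[OF e3] solve[OF e]
  show "outcome_prob p P1 (Term P1) = (1 - p P1) / \<Delta>"
    "outcome_prob p P1 (Term P2) = p P1 * (1 - p P2) / \<Delta>"
    "outcome_prob p P1 (Term P3) = p P1 * p P2 * (1 - p P3) / \<Delta>"
    "outcome_prob p P2 (Term P1) = p P2 * p P3 * (1 - p P1) / \<Delta>"
    "outcome_prob p P2 (Term P2) = (1 - p P2) / \<Delta>"
    "outcome_prob p P2 (Term P3) = p P2 * (1 - p P3) / \<Delta>"
    "outcome_prob p P3 (Term P1) = p P3 * (1 - p P1) / \<Delta>"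
    "outcome_prob p P3 (Term P2) = p P1 * p P3 * (1 - p P2) / \<Delta>"
    "outcome_prob p P3 (Term P3) = (1 - p P3) / \<Delta>"
    "outcome_prob p j Cyc = 0"
    by (subst s; simp add: mult_ac)+
qed

end

end

theory Submission
  imports Defs
begin

text \<open>
  Write $x, y, z$ for the probabilities of player $i$ and of his two successors on the cycle. If the
  cycle is left with positive probability, then $x$ influences the payoffs of player $i$ only through
  $g / (1 - xyz)$ and $x g / (1 - xyz)$, both monotone in $x$, with the direction given by the sign of $g$, where
  $g$ is a positive multiple of $\mu_i (1 - y) - y (1 - z)$. Hence equilibria are the mixed
  profiles other than the constant $1$ in which every player with $g > 0$ follows the cycle and
  every player with $g < 0$ leaves it. A player with probability $0$ or $1$ forces a contradiction
  around the cycle, so all three quantities $g$ vanish; multiplying the three equations gives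
  $p_1 p_2 p_3 = \mu_1 \mu_2 \mu_3$, after which the system becomes linear.
\<close>

section \<open>Cyclic indexing of the players and the probability of a full lap\<close>

text \<open>On a cycle of length three, two steps forward are one step back. Every argument below is
  made for a generic player \<open>i\<close>, so the threefold symmetry replaces a split into three
  cases.\<close>

abbreviation prev_player :: "player \<Rightarrow> player" where
  "prev_player i \<equiv> next_player (next_player i)"

lemma next_prev_player [simp]: "next_player (prev_player i) = i"
  by (cases i) auto

lemma next_player_neq [simp]: "next_player i \<noteq> i" "prev_player i \<noteq> i"
  by (cases i; simp)+

lemma player_cases_from:
  obtains "j = i" | "j = next_player i" | "j = prev_player i"
  by (cases i; cases j) auto

lemma all_player_from:
  assumes "P i" "P (next_player i)" "P (prev_player i)"
  shows "P j"
  using assms by (cases rule: player_cases_from[of j i]) auto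

lemma mult_le_one_eq_oneD:
  fixes a b :: real
  assumes "a * b = 1" "0 \<le> a" "a \<le> 1" "0 \<le> b" "b \<le> 1"
  shows "a = 1 \<and> b = 1"
proof -
  have "1 \<le> a" "1 \<le> b"
    using assms mult_left_le[of b a] mult_left_le_one_le[of b a] by linarith+
  then show ?thesis
    using assms by auto
qed

text \<open>A product of numbers in the unit interval is 1 only if every factor is. This keeps the
  denominators of all payoff formulas positive.\<close>

lemma cycle_prob_less_one:
  assumes "p \<in> mixed_profiles" "p \<noteq> (\<lambda>_. 1)"
  shows "p i * (p (next_player i) * p (prev_player i)) < 1"
proof -
  note b = p_bounds[OF assms(1)]
  have b2: "0 \<le> p (next_player i) * p (prev_player i)" "p (next_player i) * p (prev_player i) \<le> 1"
    using b by (simp_all add: mult_le_one)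
  have "p i * (p (next_player i) * p (prev_player i)) \<noteq> 1"
  proof
    assume *: "p i * (p (next_player i) * p (prev_player i)) = 1"
    have i1: "p i = 1" and i2: "p (next_player i) * p (prev_player i) = 1"
      using mult_le_one_eq_oneD[OF * b[of i] b2] by auto
    have "p (next_player i) = 1" "p (prev_player i) = 1"
      using mult_le_one_eq_oneD[OF i2 b b] by auto
    with i1 have "p j = 1" for j
      by (rule all_player_from[of "\<lambda>j. p j = 1"])
    then show False
      using assms(2) by auto
  qed
  moreover have "p i * (p (next_player i) * p (prev_player i)) \<le> 1"
    using b b2 by (simp add: mult_le_one)
  ultimately show ?thesis
    by simp
qed

lemma mixed_profiles_fun_upd:
  assumes "p \<in> mixed_profiles" "q \<in> {0..1}"
  shows "p(i := q) \<in> mixed_profiles"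
  using assms by (auto simp: mixed_profiles_def)

section \<open>Expected payoffs in terms of one player's probability\<close>

text \<open>Conditioning on the first move: the recursions for the outcome probabilities carry over
  by linearity. The constant profile 1 is included.\<close>

lemma expected_payoff_step:
  assumes "p \<in> mixed_profiles"
  shows "expected_payoff u p j i =
    p j * expected_payoff u p (next_player j) i + (1 - p j) * u i (Term j)"
proof -
  note T = outcome_prob_Term_eq[OF assms, of j] and C = outcome_prob_Cyc_eq[OF assms, of j]
  show ?thesis
    unfolding expected_payoff_def T C
    by (cases j) (simp_all add: algebra_simps del: outcome_prob.simps)
qed

lemma expected_payoff_all_one: "expected_payoff u (\<lambda>_. 1) j i = u i Cyc"
proof -
  have "(\<lambda>_. 1) \<in> mixed_profiles"
    by (simp add: mixed_profiles_def)
  from outcome_prob_all_one[OF this] show ?thesis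
    unfolding expected_payoff_def by (simp del: outcome_prob.simps)
qed

text \<open>The expected advantage, for player \<open>i\<close> at \<open>V i\<close>, of going
  round the cycle once and stopping on return over stopping at once. It does not depend on
  \<open>p i\<close>.\<close>

definition gain :: "payoff \<Rightarrow> profile \<Rightarrow> player \<Rightarrow> real" where
  "gain u p i =
     (1 - p (next_player i)) * (u i (Term (next_player i)) - u i (Term i)) -
     p (next_player i) * (1 - p (prev_player i)) * (u i (Term i) - u i (Term (prev_player i)))"

lemma gain_fun_upd [simp]: "gain u (p(i := q)) i = gain u p i"
  by (simp add: gain_def)

text \<open>Each lap begun contributes \<open>gain u p i\<close> in expectation, and a further lap
  begins with probability \<open>p i * m\<close>, so the contributions form a geometric
  series.\<close>

lemma expected_payoff_via_gain:
  fixes u :: payoff and p :: profile and i :: player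
  defines "m \<equiv> p (next_player i) * p (prev_player i)"
  assumes p: "p \<in> mixed_profiles" "p \<noteq> (\<lambda>_. 1)"
  shows "expected_payoff u p (next_player i) i = u i (Term i) + gain u p i / (1 - p i * m)"
    and "expected_payoff u p i i = u i (Term i) + p i * (gain u p i / (1 - p i * m))"
    and "expected_payoff u p (prev_player i) i = u i (Term i) +
      p (prev_player i) * (p i * (gain u p i / (1 - p i * m))) -
      (1 - p (prev_player i)) * (u i (Term i) - u i (Term (prev_player i)))"
proof -
  let ?W = "\<lambda>j. expected_payoff u p j i"
  have pos: "1 - p i * m > 0"
    using cycle_prob_less_one[OF p] by (simp add: m_def)
  have s1: "?W i = p i * ?W (next_player i) + (1 - p i) * u i (Term i)"
    by (rule expected_payoff_step[OF p(1)])
  have s2: "?W (next_player i) = p (next_player i) * ?W (prev_player i)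
      + (1 - p (next_player i)) * u i (Term (next_player i))"
    by (rule expected_payoff_step[OF p(1)])
  have s3: "?W (prev_player i) = p (prev_player i) * ?W i
      + (1 - p (prev_player i)) * u i (Term (prev_player i))"
    using expected_payoff_step[OF p(1), of u "prev_player i" i] by simp
  \<comment> \<open>The three first-step equations are linear in the payoffs; going once round the
    cycle eliminates the other two.\<close>
  have "(?W (next_player i) - u i (Term i)) * (1 - p i * m) = gain u p i"
    using s1 s2 s3 unfolding m_def gain_def by algebra
  then have "?W (next_player i) - u i (Term i) = gain u p i / (1 - p i * m)"
    using pos by (simp add: eq_divide_eq)
  then show 1: "?W (next_player i) = u i (Term i) + gain u p i / (1 - p i * m)"
    by simp
  show 2: "?W i = u i (Term i) + p i * (gain u p i / (1 - p i * m))"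
    unfolding s1 1 by (simp add: distrib_left left_diff_distrib)
  show "?W (prev_player i) = u i (Term i) +
      p (prev_player i) * (p i * (gain u p i / (1 - p i * m))) -
      (1 - p (prev_player i)) * (u i (Term i) - u i (Term (prev_player i)))"
    unfolding s3 2 by (simp add: algebra_simps)
qed

section \<open>Equilibria as a sign condition on the gains\<close>

definition cyclic_preferences :: "payoff \<Rightarrow> bool" where
  "cyclic_preferences u \<longleftrightarrow> (\<forall>i. u i (Term (next_player i)) > u i (Term i) \<and>
     u i (Term i) > u i (Term (prev_player i)) \<and> u i (Term (prev_player i)) > u i Cyc)"

text \<open>Infinite play is the worst outcome for everybody, so player 1 profits by stopping at
  once when the play starts at \<open>V P1\<close>.\<close>

lemma not_uniform_nash_all_one:
  assumes "cyclic_preferences u"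
  shows "\<not> uniform_nash u (\<lambda>_. 1)"
proof
  assume nash: "uniform_nash u (\<lambda>_. 1)"
  define p' :: profile where "p' = (\<lambda>_. 1)(P1 := 0)"
  have "p' \<in> mixed_profiles"
    by (auto simp: p'_def mixed_profiles_def)
  from expected_payoff_step[OF this, of u P1 P1] have "expected_payoff u p' P1 P1 = u P1 (Term P1)"
    by (simp add: p'_def)
  moreover have "expected_payoff u p' P1 P1 \<le> expected_payoff u (\<lambda>_. 1) P1 P1"
    using nash unfolding uniform_nash_def p'_def by auto
  ultimately have "u P1 (Term P1) \<le> u P1 Cyc"
    by (simp add: expected_payoff_all_one)
  moreover have "u P1 (Term P1) > u P1 Cyc"
    using assms unfolding cyclic_preferences_def by (metis less_trans)
  ultimately show False
    by simp
qed

definition obeys_gain :: "payoff \<Rightarrow> profile \<Rightarrow> bool" where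
  "obeys_gain u p \<longleftrightarrow> (\<forall>i. (gain u p i > 0 \<longrightarrow> p i = 1) \<and> (gain u p i < 0 \<longrightarrow> p i = 0))"

text \<open>Deviations to 0 and to 1, judged from the player's own position only, already force the
  sign condition.\<close>

lemma uniform_nash_obeys_gain:
  assumes nash: "uniform_nash u p" and ne: "p \<noteq> (\<lambda>_. 1)"
  shows "obeys_gain u p"
  unfolding obeys_gain_def
proof (intro allI conjI impI)
  fix i
  define m where "m = p (next_player i) * p (prev_player i)"
  define g where "g = gain u p i"
  have p: "p \<in> mixed_profiles"
    using nash by (simp add: uniform_nash_def)
  note b = p_bounds[OF p]
  note pay = expected_payoff_via_gain(2)[where i = i]
  have dev: "q * (g / (1 - q * m)) \<le> p i * (g / (1 - p i * m))"
    if "q \<in> {0..1}" "p(i := q) \<noteq> (\<lambda>_. 1)" for q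
  proof -
    have "expected_payoff u (p(i := q)) i i \<le> expected_payoff u p i i"
      using nash that by (simp add: uniform_nash_def)
    then show ?thesis
      using pay[OF mixed_profiles_fun_upd[OF p that(1)] that(2), of u] pay[OF p ne, of u]
      by (simp add: m_def g_def)
  qed
  have d: "1 - p i * m > 0"
    using cycle_prob_less_one[OF p ne, of i] by (simp add: m_def)
  {
    assume "gain u p i > 0"
    then have g: "g > 0"
      by (simp add: g_def)
    show "p i = 1"
    proof (rule ccontr)
      assume "p i \<noteq> 1"
      then have lt: "p i < 1"
        using b(2)[of i] by simp
      \<comment> \<open>The payoff formula fails at the constant profile 1. The deviation cannot
        lead there, because the gain vanishes when both other players always follow the
        cycle.\<close>
      have ne': "p(i := 1) \<noteq> (\<lambda>_. 1)"
      proof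
        assume *: "p(i := 1) = (\<lambda>_. 1)"
        have "p (next_player i) = 1" "p (prev_player i) = 1"
          using fun_cong[OF *, of "next_player i"] fun_cong[OF *, of "prev_player i"] by auto
        then show False
          using g by (simp add: g_def gain_def)
      qed
      have d': "1 - m > 0"
        using cycle_prob_less_one[OF mixed_profiles_fun_upd[OF p] ne', of i] by (simp add: m_def)
      have "g / (1 - m) \<le> p i * g / (1 - p i * m)"
        using dev[OF _ ne'] by simp
      then have "g * (1 - p i * m) \<le> p i * g * (1 - m)"
        using d d' by (simp add: divide_le_eq le_divide_eq mult_ac)
      \<comment> \<open>The terms containing \<open>m\<close> cancel.\<close>
      then have "g * (1 - p i) \<le> 0"
        by (simp add: algebra_simps)
      then show False
        using g lt by (simp add: mult_le_0_iff)
    qed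
  }
  {
    assume "gain u p i < 0"
    then have g: "g < 0"
      by (simp add: g_def)
    have "p(i := 0) \<noteq> (\<lambda>_. 1)"
      by (metis fun_upd_same zero_neq_one)
    from dev[OF _ this] have "0 \<le> p i * (g / (1 - p i * m))"
      by simp
    moreover have "g / (1 - p i * m) < 0"
      using g d by (simp add: divide_neg_pos)
    ultimately show "p i = 0"
      using b(1)[of i] by (metis antisym mult_nonneg_nonpos2 less_imp_le mult_eq_0_iff mult.commute order_less_irrefl)
  }
qed

text \<open>As functions of \<open>q\<close>, both expressions are nondecreasing for positive
  \<open>g\<close> and nonincreasing for negative \<open>g\<close>, so the required endpoint
  \<open>x\<close> maximizes both at once. For \<open>g = 0\<close> both vanish.\<close>

lemma mono_gain_quotient:
  fixes g m x q :: real
  assumes "0 \<le> m" "0 \<le> x" "x \<le> 1" "0 \<le> q" "q \<le> 1" "x * m < 1" "q * m < 1"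
    and "g > 0 \<Longrightarrow> x = 1" "g < 0 \<Longrightarrow> x = 0"
  shows "g / (1 - q * m) \<le> g / (1 - x * m)"
    and "q * (g / (1 - q * m)) \<le> x * (g / (1 - x * m))"
proof -
  have "g / (1 - q * m) \<le> g / (1 - x * m) \<and> q * (g / (1 - q * m)) \<le> x * (g / (1 - x * m))"
  proof (cases g "0 :: real" rule: linorder_cases)
    case less
    then have "x = 0"
      using assms by simp
    moreover have "g / (1 - q * m) \<le> g / 1"
      using less assms by (intro divide_left_mono_neg) auto
    moreover have "q * (g / (1 - q * m)) \<le> 0"
      using less assms by (intro mult_nonneg_nonpos) (auto simp: divide_nonpos_pos)
    ultimately show ?thesis
      by simp
  next
    case greater
    then have x: "x = 1"
      using assms by simp
    have "g / (1 - q * m) \<le> g / (1 - m)"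
      using greater assms x by (intro divide_left_mono) (auto simp: mult_left_le_one_le)
    moreover have "q * (g / (1 - q * m)) \<le> g / (1 - q * m)"
      using greater assms by (intro mult_left_le_one_le) auto
    ultimately show ?thesis
      using x by simp
  qed simp
  then show "g / (1 - q * m) \<le> g / (1 - x * m)"
    and "q * (g / (1 - q * m)) \<le> x * (g / (1 - x * m))"
    by auto
qed

text \<open>From each initial position the payoff of player \<open>i\<close> is a nondecreasing
  affine function of one of the two quotients in \<open>mono_gain_quotient\<close>, so a single
  \<open>p i\<close> is optimal from all three positions.\<close>

lemma obeys_gain_uniform_nash:
  assumes pref: "cyclic_preferences u" and p: "p \<in> mixed_profiles" "p \<noteq> (\<lambda>_. 1)"
    and obeys: "obeys_gain u p"
  shows "uniform_nash u p"
  unfolding uniform_nash_def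
proof (intro conjI allI ballI)
  show "p \<in> mixed_profiles"
    by fact
  fix j i and q :: real
  assume q: "q \<in> {0..1}"
  define m where "m = p (next_player i) * p (prev_player i)"
  note b = p_bounds[OF p(1)]
  note pay = expected_payoff_via_gain[OF p, where i = i and u = u]
  show "expected_payoff u (p(i := q)) j i \<le> expected_payoff u p j i"
  proof (cases "p(i := q) = (\<lambda>_. 1)")
    \<comment> \<open>A deviation into infinite play lies outside the payoff formula. Here the other
      two always follow the cycle, so player \<open>i\<close> now gets \<open>u i (Term i)\<close>
      from everywhere and would drop to \<open>u i Cyc\<close>.\<close>
    case True
    have one: "p (next_player i) = 1" "p (prev_player i) = 1"
      using fun_cong[OF True, of "next_player i"] fun_cong[OF True, of "prev_player i"] by auto
    then have "gain u p i = 0"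
      by (simp add: gain_def)
    then have "expected_payoff u p j i = u i (Term i)"
      using pay one by (cases rule: player_cases_from[of j i]) auto
    moreover have "u i Cyc < u i (Term i)"
      using pref unfolding cyclic_preferences_def by (metis less_trans)
    ultimately show ?thesis
      by (simp add: True expected_payoff_all_one)
  next
    case False
    note p' = mixed_profiles_fun_upd[OF p(1) q, of i] False
    note pay' = expected_payoff_via_gain[OF p', where i = i and u = u]
    have "q * m < 1" "p i * m < 1"
      using cycle_prob_less_one[OF p', of i] cycle_prob_less_one[OF p, of i] by (simp_all add: m_def)
    moreover have "0 \<le> m"
      using b by (simp add: m_def)
    ultimately have mono:
      "gain u p i / (1 - q * m) \<le> gain u p i / (1 - p i * m)"
      "q * (gain u p i / (1 - q * m)) \<le> p i * (gain u p i / (1 - p i * m))"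
      using mono_gain_quotient[of m "p i" q "gain u p i"] b[of i] q obeys
      by (auto simp: obeys_gain_def)
    show ?thesis
    proof (cases rule: player_cases_from[of j i])
      case 1
      then show ?thesis
        using pay(2) pay'(2) mono(2) by (simp add: m_def)
    next
      case 2
      then show ?thesis
        using pay(1) pay'(1) mono(1) by (simp add: m_def)
    next
      case 3
      have "p (prev_player i) * (q * (gain u p i / (1 - q * m))) \<le>
          p (prev_player i) * (p i * (gain u p i / (1 - p i * m)))"
        using mono(2) b by (intro mult_left_mono)
      then show ?thesis
        using pay(3) pay'(3) 3 by (simp add: m_def)
    qed
  qed
qed

lemma uniform_nash_iff_obeys_gain:
  assumes "cyclic_preferences u"
  shows "uniform_nash u p \<longleftrightarrow> p \<in> mixed_profiles \<and> p \<noteq> (\<lambda>_. 1) \<and> obeys_gain u p"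
  using uniform_nash_obeys_gain obeys_gain_uniform_nash not_uniform_nash_all_one assms
  by (metis uniform_nash_def)

section \<open>Payoff ratios, and why equilibria are interior\<close>

text \<open>The ratio \<mu> of the theorem, written uniformly for all players.\<close>

definition gain_ratio :: "payoff \<Rightarrow> player \<Rightarrow> real" where
  "gain_ratio u i = (u i (Term (next_player i)) - u i (Term i)) /
     (u i (Term i) - u i (Term (prev_player i)))"

lemma gain_ratio_pos: "cyclic_preferences u \<Longrightarrow> gain_ratio u i > 0"
  by (simp add: cyclic_preferences_def gain_ratio_def)

lemma gain_eq_gain_ratio:
  assumes "cyclic_preferences u"
  shows "gain u p i = (u i (Term i) - u i (Term (prev_player i))) *
    (gain_ratio u i * (1 - p (next_player i)) - p (next_player i) * (1 - p (prev_player i)))"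
proof -
  have "u i (Term i) - u i (Term (prev_player i)) \<noteq> 0"
    using assms unfolding cyclic_preferences_def by (metis less_irrefl right_minus_eq)
  then have "u i (Term (next_player i)) - u i (Term i) =
      gain_ratio u i * (u i (Term i) - u i (Term (prev_player i)))"
    by (simp add: gain_ratio_def)
  then show ?thesis
    unfolding gain_def by algebra
qed

lemma sgn_gain:
  assumes "cyclic_preferences u"
  shows "sgn (gain u p i) =
    sgn (gain_ratio u i * (1 - p (next_player i)) - p (next_player i) * (1 - p (prev_player i)))"
  using assms by (simp add: gain_eq_gain_ratio sgn_mult cyclic_preferences_def)

lemma gain_sign_iff:
  assumes "cyclic_preferences u"
  shows "gain u p i > 0 \<longleftrightarrow>
      p (next_player i) * (1 - p (prev_player i)) < gain_ratio u i * (1 - p (next_player i))"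
    and "gain u p i < 0 \<longleftrightarrow>
      p (next_player i) * (1 - p (prev_player i)) > gain_ratio u i * (1 - p (next_player i))"
  using sgn_gain[OF assms, of p i] by (auto simp: sgn_if split: if_splits)

text \<open>A player who surely follows the cycle makes some neighbour's or his own gain have a
  definite sign, and tracing the forced moves round the cycle gives a contradiction.\<close>

lemma obeys_gain_less_one:
  assumes pref: "cyclic_preferences u" and p: "p \<in> mixed_profiles" "p \<noteq> (\<lambda>_. 1)"
    and obeys: "obeys_gain u p"
  shows "p i < 1"
proof (rule ccontr)
  assume "\<not> p i < 1"
  then have x: "p i = 1"
    using p_bounds[OF p(1), of i] by simp
  note up = obeys[unfolded obeys_gain_def gain_sign_iff[OF pref], rule_format, THEN conjunct1, rule_format]
    and down = obeys[unfolded obeys_gain_def gain_sign_iff[OF pref], rule_format, THEN conjunct2, rule_format]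
  note ratio = gain_ratio_pos[OF pref]
  show False
  proof (cases "p (next_player i) = 1")
    case False
    then have "p (next_player i) < 1"
      using p_bounds[OF p(1), of "next_player i"] by simp
    \<comment> \<open>The predecessor has negative gain, so he leaves. This makes the gain of the
      successor positive, who must then follow.\<close>
    then have "p (prev_player i) = 0"
      using down[of "prev_player i"] x by simp
    then have "p (next_player i) = 1"
      using up[of "next_player i"] ratio[of "next_player i"] by simp
    with False show False ..
  next
    case True
    then have "p (prev_player i) \<noteq> 1"
      using all_player_from[of "\<lambda>j. p j = 1" i] x p(2) by auto
    then have "p (prev_player i) < 1"
      using p_bounds[OF p(1), of "prev_player i"] by simp
    \<comment> \<open>Beyond \<open>V i\<close> the play can now leave the cycle only at the
      predecessor's terminal, which player \<open>i\<close> likes less than his own, so he should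
      stop.\<close>
    then have "p i = 0"
      using down[of i] True by simp
    with x show False
      by simp
  qed
qed

text \<open>If player \<open>i\<close> surely stops, his terminal is the favourite of his
  predecessor, who then follows with probability 1, which is already excluded.\<close>

lemma obeys_gain_pos:
  assumes "cyclic_preferences u" "p \<in> mixed_profiles" "p \<noteq> (\<lambda>_. 1)" "obeys_gain u p"
  shows "p i > 0"
proof (rule ccontr)
  assume "\<not> p i > 0"
  then have "p i = 0"
    using p_bounds[OF assms(2), of i] by simp
  then have "gain u p (prev_player i) > 0"
    using gain_ratio_pos[OF assms(1), of "prev_player i"] by (simp add: gain_sign_iff(1)[OF assms(1)])
  then show False
    using assms(4) obeys_gain_less_one[OF assms, of "prev_player i"] by (auto simp: obeys_gain_def)
qed

section \<open>The indifference equations and their solution\<close>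

text \<open>All three gains vanish at an interior profile, with the positive payoff factor
  cancelled. Only the ratios remain.\<close>

definition indifferent :: "(player \<Rightarrow> real) \<Rightarrow> profile \<Rightarrow> bool" where
  "indifferent \<mu> p \<longleftrightarrow> (\<forall>i. 0 < p i \<and> p i < 1 \<and>
     p (next_player i) * (1 - p (prev_player i)) = \<mu> i * (1 - p (next_player i)))"

lemma uniform_nash_iff_indifferent:
  assumes pref: "cyclic_preferences u"
  shows "uniform_nash u p \<longleftrightarrow> indifferent (gain_ratio u) p"
proof
  assume "uniform_nash u p"
  then have p: "p \<in> mixed_profiles" "p \<noteq> (\<lambda>_. 1)" "obeys_gain u p"
    by (simp_all add: uniform_nash_iff_obeys_gain[OF pref])
  show "indifferent (gain_ratio u) p"
    unfolding indifferent_def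
  proof
    fix i
    have b: "0 < p i" "p i < 1"
      using obeys_gain_pos[OF pref p] obeys_gain_less_one[OF pref p] by auto
    then have "\<not> gain u p i > 0" "\<not> gain u p i < 0"
      using p(3) unfolding obeys_gain_def by fastforce+
    with b show "0 < p i \<and> p i < 1 \<and>
        p (next_player i) * (1 - p (prev_player i)) = gain_ratio u i * (1 - p (next_player i))"
      unfolding gain_sign_iff[OF pref] by linarith
  qed
next
  assume ind: "indifferent (gain_ratio u) p"
  have "p \<in> mixed_profiles"
    using ind by (auto simp: indifferent_def mixed_profiles_def less_imp_le)
  moreover have "p \<noteq> (\<lambda>_. 1)"
    using ind by (auto simp: indifferent_def)
  moreover have "obeys_gain u p"
    using ind by (simp add: obeys_gain_def gain_sign_iff[OF pref] indifferent_def)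
  ultimately show "uniform_nash u p"
    by (simp add: uniform_nash_iff_obeys_gain[OF pref])
qed

text \<open>In the product of the three equations the factors \<open>1 - p j\<close> occur on both
  sides and are nonzero, so they cancel.\<close>

lemma indifferent_prod:
  assumes "indifferent \<mu> p"
  shows "p i * p (next_player i) * p (prev_player i) = \<mu> i * \<mu> (next_player i) * \<mu> (prev_player i)"
proof -
  let ?x = "p i" and ?y = "p (next_player i)" and ?z = "p (prev_player i)"
  have e: "?y * (1 - ?z) = \<mu> i * (1 - ?y)" "?z * (1 - ?x) = \<mu> (next_player i) * (1 - ?z)"
    "?x * (1 - ?y) = \<mu> (prev_player i) * (1 - ?x)"
    using assms unfolding indifferent_def by (metis next_prev_player)+
  have "(?x * ?y * ?z) * ((1 - ?x) * (1 - ?y) * (1 - ?z)) =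
      (?y * (1 - ?z)) * (?z * (1 - ?x)) * (?x * (1 - ?y))"
    by (simp add: mult_ac)
  also have "\<dots> = (\<mu> i * \<mu> (next_player i) * \<mu> (prev_player i)) * ((1 - ?x) * (1 - ?y) * (1 - ?z))"
    unfolding e by (simp add: mult_ac)
  finally show ?thesis
    using assms by (simp add: indifferent_def less_imp_neq)
qed

text \<open>The coefficient met on solving the system for a single probability.\<close>

definition cycle_weight :: "(player \<Rightarrow> real) \<Rightarrow> player \<Rightarrow> real" where
  "cycle_weight \<mu> i = 1 + \<mu> i + \<mu> i * \<mu> (next_player i)"

lemma cycle_weight_pos: "(\<And>i. \<mu> i > 0) \<Longrightarrow> cycle_weight \<mu> i > 0"
  by (simp add: cycle_weight_def add_pos_pos)

definition cycle_solution :: "(player \<Rightarrow> real) \<Rightarrow> profile" where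
  "cycle_solution \<mu> i = \<mu> (prev_player i) * cycle_weight \<mu> i / cycle_weight \<mu> (prev_player i)"

lemma indifferent_unique:
  assumes pos: "\<And>i. \<mu> i > 0" and ind: "indifferent \<mu> p"
  shows "p = cycle_solution \<mu>"
proof
  fix i
  let ?x = "p i" and ?y = "p (next_player i)" and ?z = "p (prev_player i)"
  have e: "?y * (1 - ?z) = \<mu> i * (1 - ?y)" "?x * (1 - ?y) = \<mu> (prev_player i) * (1 - ?x)"
    using ind unfolding indifferent_def by (metis next_prev_player)+
  \<comment> \<open>With the triple product known, \<open>?x * ?y\<close> becomes affine in
    \<open>?x\<close>; inserting this into the second equation of \<open>e\<close> leaves a linear
    equation in \<open>?x\<close> alone.\<close>
  have "?x * ?y = ?x * (?y * (1 - ?z)) + ?x * ?y * ?z"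
    by (simp add: algebra_simps)
  also have "\<dots> = \<mu> i * (?x * (1 - ?y)) + \<mu> i * \<mu> (next_player i) * \<mu> (prev_player i)"
    unfolding e(1) indifferent_prod[OF ind] by simp
  finally have "?x * ?y = \<mu> i * (\<mu> (prev_player i) * (1 - ?x)) +
      \<mu> i * \<mu> (next_player i) * \<mu> (prev_player i)"
    unfolding e(2) .
  then have "?x * cycle_weight \<mu> (prev_player i) = \<mu> (prev_player i) * cycle_weight \<mu> i"
    using e(2) by (simp add: cycle_weight_def algebra_simps)
  moreover have "cycle_weight \<mu> (prev_player i) \<noteq> 0"
    using cycle_weight_pos[of \<mu>, OF pos] by (metis less_irrefl)
  ultimately show "?x = cycle_solution \<mu> i"
    by (simp add: cycle_solution_def eq_divide_eq)
qed

lemma indifferent_cycle_solution: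
  assumes pos: "\<And>i. \<mu> i > 0" and less: "\<And>i. \<mu> i * \<mu> (next_player i) * \<mu> (prev_player i) < 1"
  shows "indifferent \<mu> (cycle_solution \<mu>)"
  unfolding indifferent_def
proof (intro allI conjI)
  fix i
  let ?m = "\<mu> i * \<mu> (next_player i) * \<mu> (prev_player i)"
  note D = cycle_weight_pos[of \<mu>, OF pos]
  note D0 = D[THEN less_imp_neq, symmetric]
  \<comment> \<open>The numerator here is the same for every player. Hence all three bounds below 1
    come from the one condition on the product of the ratios, and the indifference equations reduce
    to cancelling weights.\<close>
  have compl: "1 - cycle_solution \<mu> j =
      (1 - \<mu> j * \<mu> (next_player j) * \<mu> (prev_player j)) / cycle_weight \<mu> (prev_player j)" for j
  proof -
    have "cycle_weight \<mu> (prev_player j) - \<mu> (prev_player j) * cycle_weight \<mu> j =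
        1 - \<mu> j * \<mu> (next_player j) * \<mu> (prev_player j)"
      by (simp add: cycle_weight_def algebra_simps)
    then show ?thesis
      using D0[of "prev_player j"] by (simp add: cycle_solution_def diff_divide_distrib[symmetric] field_simps)
  qed
  show "0 < cycle_solution \<mu> i"
    using pos D by (simp add: cycle_solution_def)
  have "0 < 1 - cycle_solution \<mu> i"
    unfolding compl using less[of i] D by simp
  then show "cycle_solution \<mu> i < 1"
    by simp
  have y: "1 - cycle_solution \<mu> (next_player i) = (1 - ?m) / cycle_weight \<mu> i"
    and z: "1 - cycle_solution \<mu> (prev_player i) = (1 - ?m) / cycle_weight \<mu> (next_player i)"
    unfolding compl by (simp_all add: mult_ac)
  have "cycle_solution \<mu> (next_player i) = \<mu> i * cycle_weight \<mu> (next_player i) / cycle_weight \<mu> i"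
    by (simp add: cycle_solution_def)
  then show "cycle_solution \<mu> (next_player i) * (1 - cycle_solution \<mu> (prev_player i)) =
      \<mu> i * (1 - cycle_solution \<mu> (next_player i))"
    unfolding y z using D0[of "next_player i"] by simp
qed

theorem proposition5:
  fixes u :: payoff and \<mu>1 \<mu>2 \<mu>3 :: real
  assumes "u P1 (Term P2) > u P1 (Term P1)" "u P1 (Term P1) > u P1 (Term P3)"
      "u P1 (Term P3) > u P1 Cyc"
    and "u P2 (Term P3) > u P2 (Term P2)" "u P2 (Term P2) > u P2 (Term P1)"
      "u P2 (Term P1) > u P2 Cyc"
    and "u P3 (Term P1) > u P3 (Term P3)" "u P3 (Term P3) > u P3 (Term P2)"
      "u P3 (Term P2) > u P3 Cyc"
    and "\<mu>1 = (u P1 (Term P2) - u P1 (Term P1)) / (u P1 (Term P1) - u P1 (Term P3))"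
    and "\<mu>2 = (u P2 (Term P3) - u P2 (Term P2)) / (u P2 (Term P2) - u P2 (Term P1))"
    and "\<mu>3 = (u P3 (Term P1) - u P3 (Term P3)) / (u P3 (Term P3) - u P3 (Term P2))"
  shows "(\<mu>1 * \<mu>2 * \<mu>3 \<ge> 1 \<longrightarrow> \<not> (\<exists>p. uniform_nash u p)) \<and>
    (\<mu>1 * \<mu>2 * \<mu>3 < 1 \<longrightarrow>
      (\<exists>!p. uniform_nash u p) \<and>
      (\<forall>p. uniform_nash u p \<longrightarrow>
        p P1 = \<mu>3 * (1 + \<mu>1 + \<mu>1 * \<mu>2) / (1 + \<mu>3 + \<mu>3 * \<mu>1) \<and>
        p P2 = \<mu>1 * (1 + \<mu>2 + \<mu>2 * \<mu>3) / (1 + \<mu>1 + \<mu>1 * \<mu>2) \<and>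
        p P3 = \<mu>2 * (1 + \<mu>3 + \<mu>3 * \<mu>1) / (1 + \<mu>2 + \<mu>2 * \<mu>3)))"
proof -
  have pref: "cyclic_preferences u"
    unfolding cyclic_preferences_def
  proof
    fix i
    show "u i (Term (next_player i)) > u i (Term i) \<and>
      u i (Term i) > u i (Term (prev_player i)) \<and> u i (Term (prev_player i)) > u i Cyc"
      using assms(1-9) by (cases i) auto
  qed
  let ?\<mu> = "gain_ratio u"
  have \<mu>: "?\<mu> P1 = \<mu>1" "?\<mu> P2 = \<mu>2" "?\<mu> P3 = \<mu>3"
    using assms(10-12) by (simp_all add: gain_ratio_def)
  note nash_iff = uniform_nash_iff_indifferent[OF pref] and pos = gain_ratio_pos[OF pref]
  \<comment> \<open>The product of the probabilities at an equilibrium is below 1, and it equals the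
    product of the ratios.\<close>
  have none: "\<not> uniform_nash u p" if "\<mu>1 * \<mu>2 * \<mu>3 \<ge> 1" for p
  proof
    assume "uniform_nash u p"
    then have ind: "indifferent ?\<mu> p"
      by (simp add: nash_iff)
    then have "p \<in> mixed_profiles" "p \<noteq> (\<lambda>_. 1)"
      by (auto simp: indifferent_def mixed_profiles_def less_imp_le)
    from cycle_prob_less_one[OF this, of P1] indifferent_prod[OF ind, of P1] that show False
      by (simp add: \<mu> mult.assoc)
  qed
  have unique: "p = cycle_solution ?\<mu>" if "uniform_nash u p" for p
    using indifferent_unique[of ?\<mu>, OF pos] that by (simp add: nash_iff)
  have "uniform_nash u (cycle_solution ?\<mu>)" if "\<mu>1 * \<mu>2 * \<mu>3 < 1"
  proof -
    have "?\<mu> i * ?\<mu> (next_player i) * ?\<mu> (prev_player i) < 1" for i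
      using that by (cases i) (simp_all add: \<mu> mult_ac)
    from indifferent_cycle_solution[of ?\<mu>, OF pos this] show ?thesis
      by (simp add: nash_iff)
  qed
  moreover have "cycle_solution ?\<mu> P1 = \<mu>3 * (1 + \<mu>1 + \<mu>1 * \<mu>2) / (1 + \<mu>3 + \<mu>3 * \<mu>1)"
    "cycle_solution ?\<mu> P2 = \<mu>1 * (1 + \<mu>2 + \<mu>2 * \<mu>3) / (1 + \<mu>1 + \<mu>1 * \<mu>2)"
    "cycle_solution ?\<mu> P3 = \<mu>2 * (1 + \<mu>3 + \<mu>3 * \<mu>1) / (1 + \<mu>2 + \<mu>2 * \<mu>3)"
    by (simp_all add: cycle_solution_def cycle_weight_def \<mu>)
  ultimately show ?thesis
    using none unique by metis
qed

end
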